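(* Let $G$ be a graph with $n$ vertices, and $m\le\frac n8\log_{1/(1-\psi)}n=\Theta\bigl(\frac n\psi\log n\bigr)$ edges. Let $H$ be a graph randomly sampled from $\mathcal D(G,\psi)$. Then $\mathbb E[f(H)]\ge n^{3/2}/8$.
   Context: Here $\psi\in(0,1)$ is a parameter and the vertex set of $G$ is $[n]=\{1,\dots,n\}$. For a graph $G$ with vertex set $[n]$ and $i<j$, a straight path from $i$ to $j$ in $G$ is a path $i=i_1<i_2<\dots<i_t=j$ all of whose consecutive pairs are edges of $G$. The deficiency $f(G)$ is the number of pairs $i<j$ in $[n]$ with no straight path from $i$ to $j$ in $G$. $\mathcal D(G,\psi)$ is the distribution of the random subgraph of $G$ (same vertex set) in which each edge of $G$ is kept independently with probability $\psi$.
   Formalization: The bound is stated for n ≥ 2 (it fails for n = 1, where f(H) = 0 < 1/8), and the Θ-estimate is stated as n → ∞ uniformly for ψ in (0,c] for each c < 1, since uniformity over all of (0,1) fails as ψ → 1. *)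

theory Defs
  imports "HOL-Probability.Probability"
begin

definition graph_on :: "nat \<Rightarrow> nat set set \<Rightarrow> bool" where
  "graph_on n E \<longleftrightarrow> (\<forall>e\<in>E. e \<subseteq> {1..n} \<and> card e = 2)"

definition straight_path :: "nat set set \<Rightarrow> nat \<Rightarrow> nat \<Rightarrow> nat list \<Rightarrow> bool" where
  "straight_path E i j xs \<longleftrightarrow>
     xs \<noteq> [] \<and> hd xs = i \<and> last xs = j \<and> successively (\<lambda>a b. a < b \<and> {a, b} \<in> E) xs"

definition deficiency :: "nat \<Rightarrow> nat set set \<Rightarrow> nat" where
  "deficiency n E = card {(i, j). i \<in> {1..n} \<and> j \<in> {1..n} \<and> i < j \<and> (\<nexists>xs. straight_path E i j xs)}"

(* The distribution D(G, psi). Pi_pmf draws an independent Bernoulli(psi) coin for each edge;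
   it requires E to be finite, which graph_on guarantees. *)
definition random_subgraph :: "nat set set \<Rightarrow> real \<Rightarrow> nat set set pmf" where
  "random_subgraph E \<psi> = map_pmf (\<lambda>keep. {e \<in> E. keep e}) (Pi_pmf E False (\<lambda>_. bernoulli_pmf \<psi>))"

end

theory Submission
  imports Defs
begin

text \<open>
  If \<open>i\<close> loses all its edges to larger vertices, then none of the \<open>n - i\<close> larger vertices is
  reachable from \<open>i\<close>; this happens with probability \<open>(1 - \<psi>) ^ d i\<close>, where \<open>d i\<close> is the number
  of such edges. The \<open>d i\<close> sum to at most \<open>m\<close>, so by convexity of \<open>x \<mapsto> (1 - \<psi>) powr x\<close> the lower
  half of the vertices alone already contributes at least \<open>n powr (13/8) / 6\<close>.
\<close>

definition up_edges :: "nat set set \<Rightarrow> nat \<Rightarrow> nat set set" where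
  "up_edges E i = {e \<in> E. \<exists>j>i. e = {i, j}}"

text \<open>Every edge is charged only to its smaller endpoint, so the sets being counted are
  pairwise disjoint subsets of \<open>E\<close>.\<close>

lemma sum_card_up_edges_le:
  assumes "finite E" "finite I"
  shows "(\<Sum>i\<in>I. card (up_edges E i)) \<le> card E"
proof -
  have "(\<Sum>i\<in>I. card (up_edges E i)) = card (\<Union>i\<in>I. up_edges E i)"
    using assms by (subst card_UN_disjoint) (auto simp: up_edges_def doubleton_eq_iff)
  also have "\<dots> \<le> card E"
    using assms by (intro card_mono) (auto simp: up_edges_def)
  finally show ?thesis .
qed

text \<open>The first step of such a path would be an edge in \<open>up_edges H i\<close>; the
  one-vertex path ends at \<open>i\<close> and is excluded by \<open>i < j\<close>.\<close>

lemma not_straight_path_if_no_up_edges: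
  assumes "up_edges H i = {}" "i < j"
  shows "\<not> straight_path H i j xs"
proof
  assume *: "straight_path H i j xs"
  then obtain ys where "xs = i # ys"
    unfolding straight_path_def by (cases xs) auto
  with * assms show False
    by (cases ys) (auto simp: straight_path_def up_edges_def)
qed

text \<open>The missing pairs are grouped by their first entry. The cutoff \<open>N\<close> stays
  free here; it later becomes \<open>n div 2\<close>, which keeps every weight \<open>n - i\<close>
  at least n/2.\<close>

lemma deficiency_ge_sum:
  assumes "N \<le> n"
  shows "(\<Sum>i\<in>{1..N}. real (n - i) * of_bool (up_edges H i = {})) \<le> real (deficiency n H)"
proof -
  define I where "I = {i \<in> {1..N}. up_edges H i = {}}"
  have "(\<Sum>i\<in>{1..N}. real (n - i) * of_bool (up_edges H i = {})) = (\<Sum>i\<in>I. real (n - i))"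
    unfolding I_def by (rule sum.mono_neutral_cong_right) auto
  also have "\<dots> = real (card (SIGMA i:I. {i<..n}))"
    by (subst card_SigmaI) (auto simp: I_def)
  also have "\<dots> \<le> real (deficiency n H)"
    unfolding deficiency_def of_nat_le_iff
  proof (rule card_mono)
    show "finite {(i, j). i \<in> {1..n} \<and> j \<in> {1..n} \<and> i < j \<and> (\<nexists>xs. straight_path H i j xs)}"
      by (rule finite_subset[of _ "{1..n} \<times> {1..n}"]) auto
  qed (use assms not_straight_path_if_no_up_edges in \<open>auto simp: I_def\<close>)
  finally show ?thesis .
qed

lemma expectation_no_up_edges:
  assumes "finite E" "0 \<le> \<psi>" "\<psi> \<le> 1"
  shows "measure_pmf.expectation (random_subgraph E \<psi>) (\<lambda>H. of_bool (up_edges H i = {})) =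
    (1 - \<psi>) ^ card (up_edges E i)"
proof -
  let ?P = "Pi_pmf E False (\<lambda>_. bernoulli_pmf \<psi>)"
  \<comment> \<open>The event is a box in the space of coins: the upward edges of \<open>i\<close>
    must show \<open>False\<close>, all other coins are free. Independence then turns its
    probability into a product over \<open>E\<close>.\<close>
  let ?B = "\<lambda>e. if e \<in> up_edges E i then {False} else UNIV"
  have "measure_pmf.expectation (random_subgraph E \<psi>) (\<lambda>H. of_bool (up_edges H i = {})) =
      measure_pmf.expectation ?P (indicator (Pi E ?B) :: _ \<Rightarrow> real)"
    unfolding random_subgraph_def integral_map_pmf
    by (intro Bochner_Integration.integral_cong) (auto simp: up_edges_def indicator_def Pi_def)
  also have "\<dots> = measure_pmf.prob ?P (Pi E ?B)"
    by simp
  also have "\<dots> = (\<Prod>e\<in>E. measure_pmf.prob (bernoulli_pmf \<psi>) (?B e))"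
    by (rule measure_Pi_pmf_Pi) fact
  also have "\<dots> = (\<Prod>e\<in>E. if e \<in> up_edges E i then 1 - \<psi> else 1)"
    using assms by (intro prod.cong) (auto simp: measure_pmf_single)
  also have "\<dots> = (1 - \<psi>) ^ card (up_edges E i)"
  proof -
    have "E \<inter> {e. e \<in> up_edges E i} = up_edges E i"
      by (auto simp: up_edges_def)
    then show ?thesis
      using assms by (simp add: prod.If_cases)
  qed
  finally show ?thesis .
qed

lemma expectation_deficiency_ge:
  assumes "finite E" "0 \<le> \<psi>" "\<psi> \<le> 1" "N \<le> n"
  shows "(\<Sum>i\<in>{1..N}. real (n - i) * (1 - \<psi>) ^ card (up_edges E i))
    \<le> measure_pmf.expectation (random_subgraph E \<psi>) (\<lambda>H. real (deficiency n H))"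
proof -
  let ?M = "random_subgraph E \<psi>"
  \<comment> \<open>Finite support makes every real function integrable, as linearity and
    monotonicity of the expectation require.\<close>
  have "finite (set_pmf ?M)"
    by (rule finite_subset[of _ "Pow E"]) (auto simp: random_subgraph_def \<open>finite E\<close>)
  then have int: "integrable ?M g" for g :: "nat set set \<Rightarrow> real"
    by (rule integrable_measure_pmf_finite)
  have "(\<Sum>i\<in>{1..N}. real (n - i) * (1 - \<psi>) ^ card (up_edges E i)) =
    measure_pmf.expectation ?M (\<lambda>H. \<Sum>i\<in>{1..N}. real (n - i) * of_bool (up_edges H i = {}))"
  proof -
    have "measure_pmf.expectation ?M (\<lambda>H. \<Sum>i\<in>{1..N}. real (n - i) * of_bool (up_edges H i = {})) =
      (\<Sum>i\<in>{1..N}. measure_pmf.expectation ?M (\<lambda>H. real (n - i) * of_bool (up_edges H i = {})))"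
      by (rule Bochner_Integration.integral_sum) (rule int)
    then show ?thesis
      by (simp only: integral_mult_right_zero expectation_no_up_edges[OF assms(1-3)])
  qed
  also have "\<dots> \<le> measure_pmf.expectation ?M (\<lambda>H. real (deficiency n H))"
    by (intro integral_mono int deficiency_ge_sum assms)
  finally show ?thesis .
qed

text \<open>Jensen's inequality, via the tangent of \<open>exp\<close> at \<open>- a\<close>.\<close>

lemma sum_exp_minus_ge:
  fixes f :: "'a \<Rightarrow> real"
  assumes "(\<Sum>i\<in>I. f i) \<le> real (card I) * a"
  shows "real (card I) * exp (- a) \<le> (\<Sum>i\<in>I. exp (- f i))"
proof -
  \<comment> \<open>The hypothesis says exactly that the added amount
    \<open>real (card I) * a - (\<Sum>i\<in>I. f i)\<close> is nonnegative.\<close>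
  have "real (card I) * exp (- a) \<le> exp (- a) * (real (card I) * (1 + a) - (\<Sum>i\<in>I. f i))"
    using assms by (subst mult.commute, intro mult_left_mono) (simp_all add: distrib_left)
  also have "\<dots> = (\<Sum>i\<in>I. exp (- a) * (1 + (a - f i)))"
    by (simp add: sum.distrib sum_subtractf distrib_left flip: sum_distrib_left add_diff_eq)
  also have "\<dots> \<le> (\<Sum>i\<in>I. exp (- a) * exp (a - f i))"
    by (intro sum_mono mult_left_mono exp_ge_add_one_self) auto
  also have "\<dots> = (\<Sum>i\<in>I. exp (- f i))"
    by (simp flip: exp_add)
  finally show ?thesis .
qed

lemma expectation_deficiency_ge_powr:
  assumes "n \<ge> 2" "0 < \<psi>" "\<psi> < 1" "finite E"
    and m: "real (card E) \<le> real n / 8 * log (1 / (1 - \<psi>)) (real n)"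
  shows "real n powr (3 / 2) / 8
    \<le> measure_pmf.expectation (random_subgraph E \<psi>) (\<lambda>H. real (deficiency n H))"
proof -
  \<comment> \<open>For \<open>i \<le> N\<close> at least n/2 vertices lie above \<open>i\<close>,
    while \<open>N\<close> is still at least n/3; the worst case is n = 3.\<close>
  define N where "N = n div 2"
  \<comment> \<open>\<open>L\<close> is the decay rate: the k-th power of \<open>1 - \<psi>\<close>
    is exp(-Lk). The logarithm to base \<open>1 / (1 - \<psi>)\<close> is \<open>ln\<close> divided
    by \<open>L\<close>, so \<open>L\<close> cancels from the edge bound.\<close>
  define L where "L = - ln (1 - \<psi>)"
  define d where "d i = card (up_edges E i)" for i
  have "n \<le> 3 * N" "N \<le> n"
    using \<open>n \<ge> 2\<close> unfolding N_def by presburger+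
  then have N: "real n / 3 \<le> real N" "N \<le> n"
    by simp_all
  have "L > 0"
    using assms by (simp add: L_def)
  have "(\<Sum>i\<in>{1..N}. L * real (d i)) \<le> L * real (card E)"
    using sum_card_up_edges_le[OF \<open>finite E\<close>, of "{1..N}"] \<open>L > 0\<close>
    by (simp add: d_def flip: sum_distrib_left of_nat_sum)
  also have "\<dots> \<le> real n / 8 * ln (real n)"
    using m \<open>L > 0\<close> assms by (simp add: log_def L_def ln_div field_simps)
  \<comment> \<open>Here 3/8 is 1/8 times the 3 from \<open>n \<le> 3 * N\<close>; it bounds the
    average exponent per lower vertex in units of \<open>ln n\<close>.\<close>
  also have "\<dots> \<le> real N * (3 / 8 * ln (real n))"
    using mult_right_mono[OF N(1), of "3 / 8 * ln (real n)"] \<open>n \<ge> 2\<close> by simp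
  finally have "real N * exp (- (3 / 8 * ln (real n))) \<le> (\<Sum>i\<in>{1..N}. exp (- (L * real (d i))))"
    using sum_exp_minus_ge[of "\<lambda>i. L * real (d i)" "{1..N}"] by simp
  also have "\<dots> = (\<Sum>i\<in>{1..N}. (1 - \<psi>) ^ d i)"
  proof (rule sum.cong)
    fix i
    have "exp (- (L * real (d i))) = exp (real (d i) * ln (1 - \<psi>))"
      by (simp add: L_def)
    also have "\<dots> = (1 - \<psi>) ^ d i"
      using assms by (simp add: exp_of_nat_mult)
    finally show "exp (- (L * real (d i))) = (1 - \<psi>) ^ d i" .
  qed simp
  finally have sum_ge: "real N * real n powr (- 3 / 8) \<le> (\<Sum>i\<in>{1..N}. (1 - \<psi>) ^ d i)"
    using \<open>n \<ge> 2\<close> by (simp add: powr_def)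
  \<comment> \<open>The target is weaker than what the estimate yields, in exponent and in constant.
    The exponent 13/8 is 1 + 1 - 3/8, and 1/6 is 1/2 times 1/3: n/2 larger vertices, n/3 lower
    vertices, and the Jensen factor.\<close>
  have "real n powr (3 / 2) / 8 \<le> real n powr (13 / 8) / 6"
  proof -
    have "real n powr (3 / 2) \<le> real n powr (13 / 8)"
      using \<open>n \<ge> 2\<close> by (intro powr_mono) auto
    then show ?thesis
      using powr_ge_zero[of "real n" "13 / 8"] by linarith
  qed
  also have "real n powr (13 / 8) = real n powr 1 * real n powr 1 * real n powr (- 3 / 8)"
    by (simp only: powr_add[symmetric]) simp
  also have "\<dots> / 6 = real n / 2 * (real n / 3 * real n powr (- 3 / 8))"
    by simp
  also have "\<dots> \<le> real n / 2 * (real N * real n powr (- 3 / 8))"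
    by (intro mult_left_mono mult_right_mono N) auto
  also have "\<dots> \<le> real n / 2 * (\<Sum>i\<in>{1..N}. (1 - \<psi>) ^ d i)"
    by (intro mult_left_mono sum_ge) auto
  also have "\<dots> \<le> (\<Sum>i\<in>{1..N}. real (n - i) * (1 - \<psi>) ^ d i)"
    unfolding sum_distrib_left N_def using assms by (intro sum_mono mult_right_mono) auto
  also have "\<dots> \<le> measure_pmf.expectation (random_subgraph E \<psi>) (\<lambda>H. real (deficiency n H))"
    unfolding d_def using assms N by (intro expectation_deficiency_ge) auto
  finally show ?thesis .
qed

text \<open>Both bounds are ln x \<le> x - 1, taken at x = 1 - p and at x = 1/(1 - p).\<close>

lemma minus_ln_one_minus_bounds:
  fixes p :: real
  assumes "p < 1"
  shows "p \<le> - ln (1 - p)" and "- ln (1 - p) \<le> p / (1 - p)"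
proof -
  show "p \<le> - ln (1 - p)"
    using ln_le_minus_one[of "1 - p"] assms by simp
  have "- ln (1 - p) = ln (1 / (1 - p))"
    using assms by (simp add: ln_div)
  also have "\<dots> \<le> 1 / (1 - p) - 1"
    using assms by (intro ln_le_minus_one) auto
  also have "\<dots> = p / (1 - p)"
    using assms by (simp add: field_simps)
  finally show "- ln (1 - p) \<le> p / (1 - p)" .
qed

text \<open>With l = -ln(1 - p), the left function is p/(8l) times the right one, and p/l lies
  between 1 - c and 1. The range of p stops at c < 1 because p/l tends to 0 as p tends to 1; the
  constants depend on c but not on p.\<close>

lemma edge_bound_bigtheta:
  fixes c :: real
  assumes "0 < c" "c < 1"
  shows "(\<lambda>(k::nat, p::real). real k / 8 * log (1 / (1 - p)) (real k))
    \<in> \<Theta>[at_top \<times>\<^sub>F principal {0<..c}](\<lambda>(k, p). real k / p * ln (real k))"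
proof -
  let ?f = "\<lambda>(k::nat, p::real). real k / 8 * log (1 / (1 - p)) (real k)"
  let ?g = "\<lambda>(k::nat, p::real). real k / p * ln (real k)"
  let ?F = "at_top \<times>\<^sub>F principal {0<..c}"
  have ev: "eventually (\<lambda>x. snd x \<in> {0<..c}) ?F"
    by (rule eventually_prodI[where P = "\<lambda>_. True" and Q = "\<lambda>p. p \<in> {0<..c}", THEN eventually_mono])
      (auto simp: eventually_principal)
  \<comment> \<open>These inequalities hold for every \<open>k\<close>, so only the range of
    \<open>p\<close> is taken from the filter.\<close>
  have bounds: "norm (?f x) \<le> 1 / 8 * norm (?g x) \<and> (1 - c) / 8 * norm (?g x) \<le> norm (?f x)"
    if x: "snd x \<in> {0<..c}" for x
  proof -
    obtain k p where [simp]: "x = (k, p)" by (cases x)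
    have p: "0 < p" "p \<le> c" "p < 1"
      using x assms by auto
    define l where "l = - ln (1 - p)"
    have "p \<le> l" "l \<le> p / (1 - p)"
      unfolding l_def using minus_ln_one_minus_bounds p by auto
    have "p / (1 - p) \<le> p / (1 - c)"
      using p assms by (intro divide_left_mono) auto
    with \<open>l \<le> _\<close> have "l \<le> p / (1 - c)"
      by linarith
    then have "(1 - c) * l \<le> p"
      using assms by (simp add: field_simps)
    define t where "t = real k * ln (real k)"
    have "t \<ge> 0"
      \<comment> \<open>For \<open>k = 0\<close> the factor \<open>real k\<close> makes the product
        vanish; otherwise \<open>ln (real k)\<close> is nonnegative.\<close>
      unfolding t_def by (cases "k = 0") auto
    have f: "?f x = t / 8 * (1 / l)"
      using p by (simp add: log_def l_def t_def ln_div)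
    have g: "?g x = t * (1 / p)"
      by (simp add: t_def)
    have "1 / l \<le> 1 / p" "(1 - c) * (1 / p) \<le> 1 / l"
      using p \<open>p \<le> l\<close> \<open>(1 - c) * l \<le> p\<close> by (auto simp: field_simps)
    from this[THEN mult_left_mono, of "t / 8"] show ?thesis
      unfolding f g using \<open>t \<ge> 0\<close> p \<open>p \<le> l\<close> by (simp add: abs_mult mult_ac)
  qed
  have "?f \<in> O[?F](?g)"
    using ev bounds by (intro bigoI[of _ "1 / 8"]) (auto elim: eventually_mono)
  moreover have "?f \<in> \<Omega>[?F](?g)"
    using assms ev bounds
    by (intro landau_omega.bigI[of "(1 - c) / 8"]) (auto elim!: eventually_mono)
  ultimately show ?thesis
    by (rule bigthetaI)
qed

theorem lemma4p1:
  fixes n m :: nat and \<psi> :: real and E :: "nat set set"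
  assumes "n \<ge> 2"
    and "0 < \<psi>" and "\<psi> < 1"
    and "graph_on n E"
    and "card E = m"
    and "real m \<le> real n / 8 * log (1 / (1 - \<psi>)) (real n)"
  shows "measure_pmf.expectation (random_subgraph E \<psi>) (\<lambda>H. real (deficiency n H))
           \<ge> real n powr (3 / 2) / 8
       \<and> (\<forall>c::real. 0 < c \<and> c < 1 \<longrightarrow>
            (\<lambda>(k::nat, p::real). real k / 8 * log (1 / (1 - p)) (real k))
              \<in> \<Theta>[at_top \<times>\<^sub>F principal {0<..c}](\<lambda>(k, p). real k / p * ln (real k)))"
proof -
  have "finite E"
    using assms(4) by (intro finite_subset[of E "Pow {1..n}"]) (auto simp: graph_on_def)
  then show ?thesis
    using assms expectation_deficiency_ge_powr edge_bound_bigtheta by auto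
qed

end
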